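(* Let $a,d,K,k$ be positive integers with $a\ge 2$, $\gcd(a,d)=1$ and $K\le (k-1)/2$, and put $r=a+K-\lfloor (a+K)/k\rfloor k$. If $r>K$, then $$ n(a,a+(K+1)d,\dots,a+k d)=\frac{a^2+2(K-1)a+(a+2K-1)k d+K(K-k-2)-k-r(r-k-2)}{2 k}, $$ and if $0\le r\le K$, then $$ n(a,a+(K+1)d,\dots,a+k d)=\frac{a^2+2(K-1)a+(a+2K-1)k d+K(K-k-2)+k-r(r-k-2)}{2 k}. $$
   Context: For positive integers $a_1,\dots,a_m$ with $\gcd(a_1,\dots,a_m)=1$, the Sylvester number $n(a_1,\dots,a_m)$ is the number of positive integers that cannot be written as $x_1a_1+\cdots+x_ma_m$ with nonnegative integers $x_i$. $\lfloor x\rfloor$ denotes the floor.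
   Formalization: In the case r > K the hypothesis a > K is added; for a ≤ K the printed formula is always false (e.g. a=2, d=1, K=2, k=5: the Sylvester number is 2, the formula gives 3). *)

theory Defs
  imports Complex_Main
begin

definition representable :: "nat list \<Rightarrow> nat \<Rightarrow> bool" where
  "representable as n \<longleftrightarrow> (\<exists>x :: nat \<Rightarrow> nat. n = (\<Sum>i<length as. x i * as ! i))"

text \<open>
  The set below is finite when the entries of the list are positive with greatest common
  divisor 1, the only case in which the Sylvester number is meant to be used (the cardinality
  of an infinite set is 0 by convention).
\<close>

definition sylvester_number :: "nat list \<Rightarrow> nat" where
  "sylvester_number as = card {n. 0 < n \<and> \<not> representable as n}"

end

theory Submission
  imports Defs "HOL-Number_Theory.Cong"
begin

text \<open>
  Since \<open>k \<ge> 2 K + 1\<close>, the multiples \<open>m * {K+1..k}\<close> of the interval of steps overlap, so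
  the semigroup consists of the numbers \<open>t * a + J * d\<close> with \<open>J = 0\<close> or
  \<open>K + 1 \<le> J \<le> t * k\<close>. Every residue class modulo \<open>a\<close> is that of \<open>j * d\<close> for exactly one
  \<open>j\<close> with \<open>K + 1 \<le> j \<le> a + K\<close>, and its least element in the semigroup is
  \<open>\<lceil>j / k\<rceil> * a + j * d\<close>, except that it is \<open>0\<close> for \<open>j = a\<close>. Summing the quotients of
  these least elements by \<open>a\<close> counts the gaps (Selmer's formula).
\<close>

section \<open>The semigroup generated by a list\<close>

lemma representable_0: "representable as 0"
  unfolding representable_def by (rule exI[of _ "\<lambda>_. 0"]) simp

lemma representable_add:
  assumes "representable as m" "representable as n"
  shows "representable as (m + n)"
proof -
  obtain x y where "m = (\<Sum>i<length as. x i * as ! i)" "n = (\<Sum>i<length as. y i * as ! i)"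
    using assms unfolding representable_def by auto
  then have "m + n = (\<Sum>i<length as. (x i + y i) * as ! i)"
    by (simp add: sum.distrib add_mult_distrib)
  then show ?thesis
    unfolding representable_def by (intro exI)
qed

lemma representable_generator:
  assumes "g \<in> set as"
  shows "representable as g"
proof -
  obtain i where i: "i < length as" "g = as ! i"
    using assms by (metis in_set_conv_nth)
  have "(\<Sum>l<length as. (if l = i then 1 else 0) * as ! l)
      = (\<Sum>l<length as. if l = i then as ! l else 0)"
    by (rule sum.cong) auto
  also have "\<dots> = g"
    using i by simp
  finally show ?thesis
    unfolding representable_def by metis
qed

lemma representable_mult:
  assumes "representable as n"
  shows "representable as (c * n)"
  by (induction c) (auto intro: representable_0 representable_add assms)

text \<open>The representable numbers are the closure of the generators and 0 under addition; as an
  induction rule this hides the coefficient functions.\<close>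

lemma representable_induct [consumes 1, case_names zero add generator]:
  assumes "representable as n"
    and zero: "P 0"
    and add: "\<And>m n. P m \<Longrightarrow> P n \<Longrightarrow> P (m + n)"
    and generator: "\<And>g. g \<in> set as \<Longrightarrow> P g"
  shows "P n"
proof -
  obtain x where x: "n = (\<Sum>i<length as. x i * as ! i)"
    using assms(1) unfolding representable_def by auto
  have mult: "P (c * g)" if "g \<in> set as" for c g
    by (induction c) (auto intro: zero add generator[OF that])
  have "P (\<Sum>i<m. x i * as ! i)" if "m \<le> length as" for m
    using that by (induction m) (auto intro!: zero add mult)
  then show ?thesis
    using x by simp
qed

text \<open>\<open>t\<close> counts the generators used and \<open>J\<close> adds up their steps,
  \<open>a\<close> having step 0. Conversely, one generator is split off at a time, by induction on
  \<open>t\<close>.\<close>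

lemma representable_arithmetic_iff:
  fixes a d K k n :: nat
  assumes Kk: "2 * K + 1 \<le> k"
  shows "representable (a # map (\<lambda>j. a + j * d) [K + 1..<k + 1]) n \<longleftrightarrow>
    (\<exists>t J. n = t * a + J * d \<and> (J = 0 \<or> K + 1 \<le> J \<and> J \<le> t * k))"
    (is "representable ?as n \<longleftrightarrow> ?P n")
proof
  assume "representable ?as n"
  then show "?P n"
  proof (induction rule: representable_induct)
    case zero
    show ?case by (intro exI[of _ 0]) simp
  next
    case (add m n)
    then obtain t J t' J' where
      "m = t * a + J * d" "J = 0 \<or> K + 1 \<le> J \<and> J \<le> t * k"
      "n = t' * a + J' * d" "J' = 0 \<or> K + 1 \<le> J' \<and> J' \<le> t' * k"
      by metis
    then show ?case
      by (intro exI[of _ "t + t'"] exI[of _ "J + J'"]) (auto simp: algebra_simps)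
  next
    case (generator g)
    then consider "g = a" | j where "K + 1 \<le> j" "j \<le> k" "g = a + j * d"
      by auto
    then show ?case
    proof cases
      case 1
      then show ?thesis by (intro exI[of _ 1] exI[of _ 0]) simp
    next
      case (2 j)
      then show ?thesis by (intro exI[of _ 1] exI[of _ j]) simp
    qed
  qed
next
  assume "?P n"
  then obtain t J where n: "n = t * a + J * d" and J: "J = 0 \<or> K + 1 \<le> J \<and> J \<le> t * k"
    by auto
  have a: "representable ?as (s * a)" for s
    by (intro representable_mult representable_generator) simp
  have gen: "representable ?as (a + j * d)" if "K + 1 \<le> j" "j \<le> k" for j
    using that by (intro representable_generator) auto
  have "representable ?as (t * a + J * d)" if "K + 1 \<le> J" "J \<le> t * k"
    using that
  proof (induction t arbitrary: J)
    case 0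
    then show ?case by simp
  next
    case (Suc t)
    have split: "Suc t * a + J * d = (a + j * d) + (t * a + (J - j) * d)" if "j \<le> J" for j
    proof -
      have "J * d = j * d + (J - j) * d"
        using that by (metis add_mult_distrib le_add_diff_inverse)
      then show ?thesis by simp
    qed
    show ?case
    proof (cases "J \<le> k")
      case True
      then show ?thesis
        using split[of J] representable_add[OF gen[of J] a[of t]] Suc.prems
        by (simp add: ac_simps del: upt_Suc)
    next
      case False
      \<comment> \<open>Take the largest step \<open>k\<close> unless the rest would be too small.
        In that case the step \<open>K + 1\<close> leaves at least \<open>K + 1\<close>, since
        \<open>J > k >= 2 * K + 1\<close>, and less than \<open>k\<close>, which is within
        \<open>t * k\<close> because \<open>t\<close> is not 0.\<close>
      define j where "j = (if K + 1 + k \<le> J then k else K + 1)"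
      have "t \<noteq> 0"
        using False Suc.prems by (intro notI) simp
      then have "k \<le> t * k"
        by simp
      moreover have "J \<le> k + t * k"
        using Suc.prems by simp
      ultimately have "K + 1 \<le> J - j" "J - j \<le> t * k"
        using False Kk unfolding j_def by (split if_split, linarith)+
      then have "representable ?as (t * a + (J - j) * d)"
        by (rule Suc.IH)
      moreover have "K + 1 \<le> j" "j \<le> k" "j \<le> J"
        using False Kk by (auto simp: j_def)
      ultimately show ?thesis
        using split[of j] representable_add[OF gen[of j]] by (simp del: upt_Suc mult_Suc)
    qed
  qed
  then show "representable ?as n"
    using n J a[of t] by auto
qed

section \<open>Counting gaps by residue classes\<close>

lemma card_gaps_eq_sum_div:
  fixes a :: nat and w :: "'i \<Rightarrow> nat"
  assumes "0 < a"
    and bij: "bij_betw (\<lambda>i. w i mod a) I {..<a}"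
    and mem: "\<And>n i. i \<in> I \<Longrightarrow> n mod a = w i mod a \<Longrightarrow> n \<in> S \<longleftrightarrow> w i \<le> n"
  shows "card (- S) = (\<Sum>i\<in>I. w i div a)"
proof -
  have fin: "finite I"
    using bij bij_betw_finite by blast
  \<comment> \<open>The numbers below \<open>w i\<close> in its class modulo \<open>a\<close>; since
    \<open>w i\<close> is the least element of \<open>S\<close> there, these are the gaps of that
    class.\<close>
  define G where "G i = (\<lambda>q. q * a + w i mod a) ` {..<w i div a}" for i
  have G_mod: "n mod a = w i mod a" if "n \<in> G i" for n i
    using that by (auto simp: G_def)
  have le_iff: "w i \<le> n \<longleftrightarrow> w i div a \<le> n div a" if "n mod a = w i mod a" for n i
  proof
    assume "w i div a \<le> n div a"
    then have "w i div a * a + w i mod a \<le> n div a * a + n mod a"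
      unfolding that by (intro add_mono mult_le_mono1) auto
    then show "w i \<le> n" by simp
  qed (rule div_le_mono)
  have "- S = (\<Union>i\<in>I. G i)"
  proof (intro equalityI subsetI)
    fix n assume n: "n \<in> - S"
    have "n mod a \<in> (\<lambda>i. w i mod a) ` I"
      using bij \<open>0 < a\<close> by (simp add: bij_betw_def)
    then obtain i where i: "i \<in> I" "n mod a = w i mod a"
      by auto
    then have "n div a < w i div a"
      using n mem le_iff by (meson ComplD not_le)
    moreover have "n = n div a * a + w i mod a"
      using i(2) by (metis div_mult_mod_eq)
    ultimately show "n \<in> (\<Union>i\<in>I. G i)"
      using i(1) by (auto simp: G_def)
  next
    fix n assume "n \<in> (\<Union>i\<in>I. G i)"
    then obtain i where i: "i \<in> I" "n \<in> G i"
      by auto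
    then have "n div a < w i div a"
      using \<open>0 < a\<close> by (auto simp: G_def)
    then show "n \<in> - S"
      using mem[OF i(1) G_mod[OF i(2)]] le_iff[OF G_mod[OF i(2)]] by simp
  qed
  moreover have "card (\<Union>i\<in>I. G i) = (\<Sum>i\<in>I. card (G i))"
  proof (rule card_UN_disjoint)
    show "\<forall>i\<in>I. \<forall>j\<in>I. i \<noteq> j \<longrightarrow> G i \<inter> G j = {}"
      using bij G_mod unfolding bij_betw_def inj_on_def by (metis disjoint_iff)
  qed (auto simp: fin G_def)
  moreover have "card (G i) = w i div a" for i
    unfolding G_def using \<open>0 < a\<close> by (subst card_image) (auto intro!: inj_onI)
  ultimately show ?thesis by simp
qed

text \<open>The remainders run through each of 0, ..., a - 1 once, so their sum depends on
  \<open>a\<close> only. With the previous count this is Selmer's formula.\<close>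

lemma sum_eq_sum_div:
  fixes a :: nat and w :: "'i \<Rightarrow> nat"
  assumes "bij_betw (\<lambda>i. w i mod a) I {..<a}"
  shows "(\<Sum>i\<in>I. real (w i)) = real a * real (\<Sum>i\<in>I. w i div a) + real a * (real a - 1) / 2"
proof -
  have "(\<Sum>i\<in>I. w i mod a) = (\<Sum>i<a. i)"
    by (rule sum.reindex_bij_betw[OF assms])
  also have "real \<dots> = real a * (real a - 1) / 2"
    by (induction a) (auto simp: field_simps)
  finally have "real (\<Sum>i\<in>I. w i mod a) = real a * (real a - 1) / 2" .
  moreover have "(\<Sum>i\<in>I. w i) = a * (\<Sum>i\<in>I. w i div a) + (\<Sum>i\<in>I. w i mod a)"
    by (simp add: sum_distrib_left flip: sum.distrib)
  ultimately show ?thesis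
    by (metis of_nat_add of_nat_mult of_nat_sum)
qed

text \<open>\<open>i div k\<close> counts the m >= 1 with m * k <= i. Exchanging the sums, each m up
  to \<open>n div k\<close> contributes n - m * k. The induction only has to watch the jumps at
  multiples of \<open>k\<close>.\<close>

lemma sum_div_lessThan:
  fixes k n :: nat
  assumes "0 < k"
  shows "(\<Sum>i<n. real (i div k)) =
    real (n div k) * real n - real k * real (n div k) * (real (n div k) + 1) / 2"
proof (induction n)
  case (Suc n)
  show ?case
  proof (cases "k dvd Suc n")
    case True
    then have div: "Suc n div k = Suc (n div k)"
      by (simp add: div_Suc dvd_eq_mod_eq_0)
    have "Suc n = k * Suc (n div k)"
      using True div by (metis dvd_mult_div_cancel)
    then have "real n + 1 = real k * (real (n div k) + 1)"
      by (metis of_nat_Suc of_nat_mult add.commute)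
    then have n: "real n = real k * (real (n div k) + 1) - 1"
      by simp
    show ?thesis
      unfolding sum.lessThan_Suc Suc.IH div of_nat_Suc unfolding n
      by (simp add: field_simps)
  next
    case False
    then have "Suc n div k = n div k"
      by (simp add: div_Suc dvd_eq_mod_eq_0)
    then show ?thesis
      by (simp add: Suc.IH algebra_simps)
  qed
qed simp

section \<open>The least elements for the arithmetic generators\<close>

lemma cong_interval_imp_le:
  fixes a K i j :: nat
  assumes "[i = j] (mod a)" "j \<le> a + K" "K < i"
  shows "j \<le> i"
proof (rule ccontr)
  assume "\<not> j \<le> i"
  then have "a dvd j - i" "0 < j - i"
    using assms(1) mod_eq_dvd_iff_nat[of i j a] by (auto simp: cong_def)
  \<comment> \<open>Distinct congruent numbers are at least \<open>a\<close> apart, but j <= a + K <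
    a + i.\<close>
  then have "a \<le> j - i"
    by (rule dvd_imp_le)
  then show False
    using assms \<open>0 < j - i\<close> by simp
qed

text \<open>Keeping both quotients symbolic lets the two cases of the theorem share one count:
  \<open>q\<close> comes from summing the ceilings, \<open>c\<close> from correcting the class of 0.
  \<open>K < a\<close> ensures that j = a lies in the interval of indices.\<close>

lemma sylvester_number_arithmetic:
  fixes a d K k :: nat
  assumes Ka: "K < a" and Kk: "2 * K + 1 \<le> k" and "coprime a d"
  defines "q \<equiv> (a + K) div k" and "c \<equiv> (a - 1) div k"
  shows "real (sylvester_number (a # map (\<lambda>j. a + j * d) [K + 1..<k + 1])) =
    real q * (real a + real K) - real k * real q * (real q + 1) / 2 - real c + (real a - 1) / 2
      + real d * (real a + 2 * real K - 1) / 2"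
    (is "real (sylvester_number ?as) = _")
proof -
  have "0 < a" using Ka by simp
  \<comment> \<open>The index is shifted, i = j - 1, which turns the ceiling of j / k into
    \<open>Suc (i div k)\<close>.\<close>
  define u where "u i = Suc (i div k) * a + Suc i * d" for i
  define w where "w i = (if Suc i = a then 0 else u i)" for i
  let ?I = "{K..<a + K}"
  have w_mod: "w i mod a = Suc i * d mod a" for i
    by (simp add: w_def u_def del: mult_Suc)
  have cancel: "[i * d = j * d] (mod a) \<longleftrightarrow> [i = j] (mod a)" for i j
    using assms(3) by (simp add: cong_mult_rcancel_nat coprime_commute)
  have "inj_on (\<lambda>i. w i mod a) ?I"
  proof (rule inj_onI)
    fix i j assume ij: "i \<in> ?I" "j \<in> ?I" "w i mod a = w j mod a"
    then have "[Suc i = Suc j] (mod a)"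
      by (simp only: w_mod cancel flip: cong_def)
    then have "Suc i \<le> Suc j" "Suc j \<le> Suc i"
      using ij cong_interval_imp_le[of "Suc i" "Suc j" a K]
        cong_interval_imp_le[of "Suc j" "Suc i" a K] by (simp_all add: cong_sym_eq)
    then show "i = j" by simp
  qed
  then have bij: "bij_betw (\<lambda>i. w i mod a) ?I {..<a}"
    using \<open>0 < a\<close> unfolding bij_betw_def
    by (intro conjI card_subset_eq) (auto simp: card_image)
  have mem: "n \<in> Collect (representable ?as) \<longleftrightarrow> w i \<le> n"
    if i: "i \<in> ?I" and n: "n mod a = w i mod a" for n i
  proof -
    have n_cong: "[n = Suc i * d] (mod a)"
      using n by (simp only: w_mod cong_def)
    have "representable ?as n \<longleftrightarrow>
      (\<exists>t J. n = t * a + J * d \<and> (J = 0 \<or> K + 1 \<le> J \<and> J \<le> t * k))"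
      by (rule representable_arithmetic_iff[OF Kk])
    also have "\<dots> \<longleftrightarrow> w i \<le> n"
    proof
      assume "\<exists>t J. n = t * a + J * d \<and> (J = 0 \<or> K + 1 \<le> J \<and> J \<le> t * k)"
      then obtain t J where tJ: "n = t * a + J * d" "J = 0 \<or> K + 1 \<le> J \<and> J \<le> t * k"
        by auto
      then have "[J * d = Suc i * d] (mod a)"
        using n_cong by (simp add: cong_def)
      then have J: "[J = Suc i] (mod a)"
        by (simp only: cancel)
      show "w i \<le> n"
      proof (cases "Suc i = a")
        case False
        \<comment> \<open>Otherwise \<open>a\<close> divides \<open>Suc i\<close>, which is
          positive, below 2 * a and different from \<open>a\<close>.\<close>
        have "J \<noteq> 0"
        proof
          assume "J = 0"
          then have "a dvd Suc i"
            using J by (simp add: cong_def dvd_eq_mod_eq_0)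
          then obtain m where m: "Suc i = a * m" ..
          moreover have "Suc i < a * 2"
            using i Ka by simp
          ultimately have "m < 2"
            by (metis mult_less_cancel1)
          then show False
            using m False by (cases m) auto
        qed
        then have KJ: "K < J" and Jt: "J \<le> t * k"
          using tJ(2) by auto
        have iJ: "Suc i \<le> J"
          using i KJ by (intro cong_interval_imp_le[OF J]) auto
        \<comment> \<open>i + 1 <= J <= t * k bounds the ceiling of (i + 1) / k by
          \<open>t\<close>.\<close>
        then have "i div k < t"
          using Jt by (intro less_mult_imp_div_less) simp
        then have "Suc (i div k) * a + Suc i * d \<le> t * a + J * d"
          using iJ by (intro add_mono mult_le_mono1) auto
        then show ?thesis
          using False tJ(1) by (simp add: w_def u_def del: mult_Suc)
      qed (simp add: w_def)
    next
      assume le: "w i \<le> n"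
      show "\<exists>t J. n = t * a + J * d \<and> (J = 0 \<or> K + 1 \<le> J \<and> J \<le> t * k)"
      proof (cases "Suc i = a")
        case True
        then have "a dvd n"
          using n by (simp add: w_def dvd_eq_mod_eq_0)
        then show ?thesis
          by (intro exI[of _ "n div a"] exI[of _ 0]) simp
      next
        case False
        then have w: "w i = Suc (i div k) * a + Suc i * d"
          by (simp add: w_def u_def)
        have "a dvd n - w i"
          using n le by (metis mod_eq_dvd_iff_nat)
        then obtain s where "n = w i + s * a"
          using le by (metis dvd_def le_add_diff_inverse mult.commute)
        then have "n = (Suc (i div k) + s) * a + Suc i * d"
          by (simp add: w algebra_simps)
        moreover have "Suc i \<le> Suc (i div k) * k"
          using Kk dividend_less_div_times[of k i] by (simp add: Suc_le_eq)
        then have "Suc i \<le> (Suc (i div k) + s) * k"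
          by (simp add: add_mult_distrib)
        moreover have "K + 1 \<le> Suc i"
          using i by simp
        ultimately show ?thesis by metis
      qed
    qed
    finally show ?thesis by simp
  qed
  have "{n. 0 < n \<and> \<not> representable ?as n} = - Collect (representable ?as)"
    using representable_0[of ?as] by (auto intro: gr0I)
  then have G: "sylvester_number ?as = (\<Sum>i\<in>?I. w i div a)"
    unfolding sylvester_number_def using card_gaps_eq_sum_div[OF \<open>0 < a\<close> bij mem] by simp
  have "a - 1 \<in> ?I"
    using Ka by auto
  \<comment> \<open>\<open>u\<close> and \<open>w\<close> differ only at i = a - 1, where
    \<open>w\<close> vanishes.\<close>
  then have "sum u ?I = sum w ?I + u (a - 1)"
    using \<open>0 < a\<close> by (simp add: sum.remove[of ?I "a - 1"])
      (auto simp: w_def intro!: sum.cong split: if_splits)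
  then have w_sum: "real (sum w ?I) = real (sum u ?I) - real (u (a - 1))"
    by simp
  have u_c: "real (u (a - 1)) = real a * (real c + 1 + real d)"
    using \<open>0 < a\<close> by (simp add: u_def c_def algebra_simps)
  have u_sum: "real (sum u ?I) =
    real a * ((\<Sum>i=K..<a + K. real (i div k)) + real a) + real d * (\<Sum>i=K..<a + K. real i + 1)"
    by (simp add: u_def sum.distrib sum_distrib_left algebra_simps)
  have div_sum: "(\<Sum>i=K..<a + K. real (i div k))
    = real q * (real a + real K) - real k * real q * (real q + 1) / 2"
  proof -
    \<comment> \<open>As \<open>K < k\<close>, the quotients below \<open>K\<close> vanish and the
      sum may start at 0.\<close>
    have "(\<Sum>i<K. real (i div k)) = 0"
      using Kk by (intro sum.neutral) auto
    moreover have "(\<Sum>i<a + K. real (i div k)) =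
      (\<Sum>i<K. real (i div k)) + (\<Sum>i=K..<a + K. real (i div k))"
      by (simp add: sum.atLeastLessThan_concat lessThan_atLeast0)
    ultimately show ?thesis
      using sum_div_lessThan[of k "a + K"] Kk by (simp add: q_def)
  qed
  have id_sum: "(\<Sum>i=K..<a + K. real i + 1) = real a * (real a + 1 + 2 * real K) / 2"
    by (induction a) (auto simp: field_simps)
  define g where "g = real (sylvester_number ?as)"
  have "real a * g + real a * (real a - 1) / 2 = real (sum w ?I)"
    unfolding g_def G of_nat_sum[of w] by (rule sum_eq_sum_div[OF bij, symmetric])
  also have "\<dots> = real a * (real q * (real a + real K) - real k * real q * (real q + 1) / 2 + real a)
      + real d * (real a * (real a + 1 + 2 * real K) / 2) - real a * (real c + 1 + real d)"
    unfolding w_sum u_c u_sum div_sum id_sum ..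
  finally have "real a * g = real a *
    (real q * (real a + real K) - real k * real q * (real q + 1) / 2 - real c + (real a - 1) / 2
      + real d * (real a + 2 * real K - 1) / 2)"
    by (simp add: field_simps)
  then show ?thesis
    using \<open>0 < a\<close> unfolding g_def by (simp del: upt_Suc)
qed

text \<open>The condition \<open>K < a\<close> in the first case cannot be dropped: for a = K = 2, k
  = 5, d = 1 the formula gives 3, but the gaps are just 1 and 3. In the second case it follows from
  r <= K.\<close>

theorem theorem3:
  fixes a d K k :: nat and r :: int
  assumes "0 < a" and "0 < d" and "0 < K" and "0 < k"
    and "2 \<le> a"
    and "gcd a d = 1"
    and "real K \<le> (real k - 1) / 2"
    and "r = int a + int K - \<lfloor>(real a + real K) / real k\<rfloor> * int k"
  shows "(r > int K \<and> K < a \<longrightarrow>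
      real (sylvester_number (a # map (\<lambda>j. a + j * d) [K + 1..<k + 1])) =
        ((real a)\<^sup>2 + 2 * (real K - 1) * real a + (real a + 2 * real K - 1) * real k * real d
          + real K * (real K - real k - 2) - real k - of_int r * (of_int r - real k - 2))
        / (2 * real k)) \<and>
    (0 \<le> r \<and> r \<le> int K \<longrightarrow>
      real (sylvester_number (a # map (\<lambda>j. a + j * d) [K + 1..<k + 1])) =
        ((real a)\<^sup>2 + 2 * (real K - 1) * real a + (real a + 2 * real K - 1) * real k * real d
          + real K * (real K - real k - 2) + real k - of_int r * (of_int r - real k - 2))
        / (2 * real k))"
proof -
  have Kk: "2 * K + 1 \<le> k"
  proof -
    have "real (2 * K + 1) \<le> real k"
      using assms(7) by simp
    then show ?thesis
      by (simp only: of_nat_le_iff)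
  qed
  have r: "r = int ((a + K) mod k)"
  proof -
    have "\<lfloor>(real a + real K) / real k\<rfloor> = int ((a + K) div k)"
      by (metis floor_divide_of_nat_eq of_nat_add)
    then show ?thesis
      using assms(8) by (simp add: of_nat_mod of_nat_div minus_div_mult_eq_mod
          del: of_nat_add flip: of_nat_add)
  qed
  define q where "q = (a + K) div k"
  define r' where "r' = (a + K) mod k"
  have aK: "a + K = k * q + r'" and "r' < k"
    using \<open>0 < k\<close> by (simp_all add: q_def r'_def)
  \<comment> \<open>Eliminating \<open>a\<close> by this equation reduces both formulas to
    polynomial identities.\<close>
  have a: "real a = real k * real q + real r' - real K"
    using arg_cong[OF aK, of real] by simp
  have r': "r = int r'" "real_of_int r = real r'"
    by (simp_all add: r r'_def)
  show ?thesis
  proof (cases "K < a")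
    case False
    \<comment> \<open>Hence r = a + K > K, and both implications hold vacuously.\<close>
    then have "a + K < k"
      using Kk by simp
    then show ?thesis
      using False r \<open>0 < a\<close> by simp
  next
    case True
    have "coprime a d"
      using assms(6) by (simp add: coprime_iff_gcd_eq_1)
    note G = sylvester_number_arithmetic[OF True Kk this, folded q_def]
    show ?thesis
    proof (cases "K < r'")
      case less: True
      \<comment> \<open>a - 1 = k * q + (r' - K - 1), with the bracket in [0, k).\<close>
      have "(a - 1) div k = q"
        using aK less \<open>r' < k\<close> by (intro div_nat_eqI) auto
      then show ?thesis
        unfolding G r' using less \<open>0 < k\<close> by (simp add: a field_simps power2_eq_square)
    next
      case le: False
      obtain p where p: "q = Suc p"
        using aK le \<open>0 < a\<close> by (cases q) auto
      \<comment> \<open>Now r' - K - 1 is negative and borrows one \<open>k\<close>. The quotient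
        drops by 1, which changes -k to +k in the numerator over 2 * k.\<close>
      have "(a - 1) div k = p"
        using aK le Kk \<open>0 < a\<close> unfolding p by (intro div_nat_eqI) auto
      then show ?thesis
        unfolding G r' using le \<open>0 < k\<close> by (simp add: a p field_simps power2_eq_square)
    qed
  qed
qed

end
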